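(* For every positive integer $d$ there is a finite constant $C_d$, depending only on $d$, with the following property. Let $\mathbb{F}$ be a field and let $\mathcal{L}_0$ be the set of all lines in $\mathbb{F}^d$ passing through $0$. For each finitely supported nonnegative function $f$ defined on $\mathcal{L}_0$, there is a function $S:\mathcal{L}_0\to\mathbb{R}_+$ such that $$S(l_1)\cdots S(l_d)\ge 1\quad\text{whenever } l_1,\dots,l_d\in\mathcal{L}_0 \text{ and }\delta(l_1,\dots,l_d)=1,$$ and $$\sum_{l\in\mathcal{L}_0}S(l)f(l)\le C_d\left(\sum_{l_1,\dots,l_d\in\mathcal{L}_0}\delta(l_1,\dots,l_d)f(l_1)\cdots f(l_d)\right)^{1/d}.$$
   Context: $\mathbb{R}_+=[0,\infty)$. For lines $l_1,\dots,l_d$ through $0$ (i.e. one-dimensional linear subspaces of $\mathbb{F}^d$), $\delta(l_1,\dots,l_d)=1$ if the directions of $l_1,\dots,l_d$ are linearly independent, and $\delta(l_1,\dots,l_d)=0$ otherwise.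
   Formalization: Adds that f is zero or the sum of δ·f(l_1)…f(l_d) is nonzero (false otherwise: for d≥2, f the indicator of one line forces S=0 there); C_d is asserted for all fields with carrier in an arbitrary fixed type, from which one constant for all fields follows. *)

theory Defs
  imports "Jordan_Normal_Form.Missing_VectorSpace" "HOL-Analysis.Infinite_Sum"
begin

text \<open>
  Fields are records as in HOL-Algebra rather than a type class: this makes it possible to quantify
  over fields inside a formula, and hence to assert a constant that does not depend on the field.
\<close>

abbreviation coord_space :: "('a, 'm) ring_scheme \<Rightarrow> nat \<Rightarrow> ('a, nat \<Rightarrow> 'a) module"
  where "coord_space F d \<equiv> LinearCombinations.ring.func_space F {..<d}"

definition lines0 :: "('a, 'm) ring_scheme \<Rightarrow> nat \<Rightarrow> (nat \<Rightarrow> 'a) set set"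
  where "lines0 F d =
    {L. VectorSpace.subspace F L (coord_space F d) \<and>
        vectorspace.dim F ((coord_space F d)\<lparr>carrier := L\<rparr>) = 1}"

text \<open>
  The library predicate \<open>lin_dep\<close> speaks about sets of vectors; together with injectivity its
  negation expresses linear independence of the family \<open>(v i)\<close>, \<open>i < d\<close>.
  Independence does not depend on the choice of the direction vectors.
\<close>

definition delta :: "('a, 'm) ring_scheme \<Rightarrow> nat \<Rightarrow> (nat \<Rightarrow> (nat \<Rightarrow> 'a) set) \<Rightarrow> real"
  where "delta F d l =
    (if \<exists>v. (\<forall>i<d. v i \<in> l i \<and> v i \<noteq> \<zero>\<^bsub>coord_space F d\<^esub>) \<and> inj_on v {..<d} \<and>
            \<not> LinearCombinations.module.lin_dep F (coord_space F d) (v ` {..<d})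
     then 1 else 0)"

text \<open>
  The \<open>d\<close>-fold sum over all \<open>d\<close>-tuples of lines. For finitely supported \<open>f\<close> only finitely many
  terms are nonzero, so \<open>infsum\<close> is the ordinary finite sum.

  If \<open>f\<close> is nonzero but supported in a hyperplane, then \<open>delta_sum F d f = 0\<close>, and no admissible \<open>S\<close>
  has \<open>\<Sum>l. S l * f l \<le> 0\<close>: such an \<open>S\<close> would vanish at some \<open>l\<close> with \<open>f l > 0\<close>, and \<open>l\<close> is part of
  a \<open>d\<close>-tuple of independent lines. Only these \<open>f\<close> violate the hypothesis
  \<open>(\<exists>l\<in>lines0 F d. f l \<noteq> 0) \<longrightarrow> delta_sum F d f \<noteq> 0\<close>.
\<close>

definition delta_sum ::
    "('a, 'm) ring_scheme \<Rightarrow> nat \<Rightarrow> ((nat \<Rightarrow> 'a) set \<Rightarrow> real) \<Rightarrow> real"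
  where "delta_sum F d f =
    (\<Sum>\<^sub>\<infinity> l \<in> {..<d} \<rightarrow>\<^sub>E lines0 F d. delta F d l * (\<Prod>i<d. f (l i)))"

end

theory Submission
  imports Defs "HOL-Analysis.Function_Topology"
begin

text \<open>
  Choose \<open>S\<close> minimising the sum of \<open>S l * f l\<close> over the support of \<open>f\<close> subject to the product
  constraints, and put \<open>g l = S l * f l\<close>. By symmetric exchange the bases for which the constraint is
  an equality are again the bases of a matroid. Multiplying \<open>S\<close> by \<open>exp (t * (k - d))\<close> on a set \<open>F\<close>
  and by \<open>exp (t * k)\<close> elsewhere keeps all constraints for small \<open>t > 0\<close> if every tight basis meets
  \<open>F\<close> in at most \<open>k\<close> elements; minimality therefore gives \<open>d * g(F) \<le> k * g(E)\<close>. Hence a tuple of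
  lines drawn independently with probability proportional to \<open>g\<close> is a tight basis with probability
  at least \<open>1 / d ^ d\<close>. On tight bases the products of \<open>f\<close> and of \<open>g\<close> agree, so \<open>C = d\<close> works.
\<close>

section \<open>Weighted bases of a matroid\<close>

text \<open>Symmetric rather than one-sided exchange is the axiom, because swapping in two bases at
  once preserves the product of their weights. \<open>BB\<close> may be empty, so no tight base has
  to be exhibited beforehand.\<close>

locale matroid_bases =
  fixes E :: "'b set" and d :: nat and BB :: "'b set set"
  assumes finite_ground: "finite E"
    and base_subset: "B \<in> BB \<Longrightarrow> B \<subseteq> E"
    and base_card: "B \<in> BB \<Longrightarrow> card B = d"
    and symmetric_exchange: "\<lbrakk>A \<in> BB; B \<in> BB; x \<in> A - B\<rbrakk> \<Longrightarrow>
      \<exists>y\<in>B - A. insert y (A - {x}) \<in> BB \<and> insert x (B - {y}) \<in> BB"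
begin

lemma finite_base: "B \<in> BB \<Longrightarrow> finite B"
  using base_subset finite_ground finite_subset by blast

section \<open>Independent sets and closure\<close>

definition indep :: "'b set \<Rightarrow> bool"
  where "indep I \<longleftrightarrow> (\<exists>B\<in>BB. I \<subseteq> B)"

text \<open>A base \<open>A\<close> that contains \<open>I\<close> and meets \<open>B\<close> as
  much as possible lies in \<open>I \<union> B\<close>, since exchanging any other element would
  enlarge \<open>A \<inter> B\<close>. Then \<open>A - I\<close> consists of
  \<open>d - card I\<close> elements of \<open>B\<close>, too many for \<open>J\<close> to
  avoid.\<close>

lemma augment:
  assumes I: "indep I" and B: "B \<in> BB" and J: "J \<subseteq> B" and less: "card I < card J"
  shows "\<exists>x\<in>J - I. indep (insert x I)"
proof -
  define P where "P = (\<lambda>A. A \<in> BB \<and> I \<subseteq> A)"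
  have "\<exists>A. P A" using I by (auto simp: P_def indep_def)
  moreover have "\<forall>A. P A \<longrightarrow> card (A \<inter> B) < Suc (card B)"
    by (meson B card_mono finite_base inf_le2 less_Suc_eq_le)
  ultimately obtain A where A: "P A" and max: "\<And>A'. P A' \<Longrightarrow> card (A' \<inter> B) \<le> card (A \<inter> B)"
    using ex_has_greatest_nat[of P _ "\<lambda>A. card (A \<inter> B)" "Suc (card B)"] by blast
  have AB: "A \<in> BB" and IA: "I \<subseteq> A" using A by (auto simp: P_def)
  have cover: "A \<subseteq> I \<union> B"
  proof (rule ccontr)
    assume "\<not> A \<subseteq> I \<union> B"
    then obtain x where x: "x \<in> A - B" "x \<notin> I" by blast
    obtain y where y: "y \<in> B - A" "insert y (A - {x}) \<in> BB"
      using symmetric_exchange[OF AB B x(1)] by blast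
    have "P (insert y (A - {x}))" using y IA x by (auto simp: P_def)
    moreover have "insert y (A - {x}) \<inter> B = insert y (A \<inter> B)" using x y by auto
    ultimately have "card (insert y (A \<inter> B)) \<le> card (A \<inter> B)" using max by metis
    then show False using y finite_base[OF AB] by simp
  qed
  have "J \<inter> (A - I) \<noteq> {}"
  proof
    assume "J \<inter> (A - I) = {}"
    then have "J \<subseteq> B - (A - I)" using J by auto
    then have "card J \<le> card (B - (A - I))" using finite_base[OF B] by (intro card_mono) auto
    also have "\<dots> = card B - card (A - I)"
      using cover finite_base[OF AB] by (intro card_Diff_subset) auto
    also have "\<dots> = card I"
      using card_Diff_subset[of I A] card_mono[of A I] base_card[OF AB] base_card[OF B]
        IA finite_base[OF AB] finite_subset[of I A] by simp
    finally show False using less by simp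
  qed
  then show ?thesis using AB IA by (auto simp: indep_def)
qed

text \<open>For independent \<open>I\<close> this is the matroid closure, the flat spanned by
  \<open>I\<close>.\<close>

definition closure :: "'b set \<Rightarrow> 'b set"
  where "closure I = {x\<in>E. x \<in> I \<or> \<not> indep (insert x I)}"

text \<open>Otherwise augmentation would add to \<open>I\<close> an element of its own
  closure.\<close>

lemma card_base_Int_closure:
  assumes "indep I" and "B \<in> BB"
  shows "card (B \<inter> closure I) \<le> card I"
proof (rule ccontr)
  assume "\<not> ?thesis"
  then obtain x where "x \<in> B \<inter> closure I - I" "indep (insert x I)"
    using augment[of I B "B \<inter> closure I"] assms by auto
  then show False by (simp add: closure_def)
qed

section \<open>Drawing independent tuples\<close>

definition indep_tuples :: "nat \<Rightarrow> (nat \<Rightarrow> 'b) set"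
  where "indep_tuples k = {l \<in> {..<k} \<rightarrow>\<^sub>E E. inj_on l {..<k} \<and> indep (l ` {..<k})}"

lemma finite_indep_tuples: "finite (indep_tuples k)"
  unfolding indep_tuples_def using finite_PiE[of "{..<k}" "\<lambda>_. E"] finite_ground by simp

lemma indep_subset: "indep I \<Longrightarrow> J \<subseteq> I \<Longrightarrow> indep J"
  unfolding indep_def by blast

text \<open>Turns a sum over longer tuples into an iterated sum, one draw after another. Tuples are
  extensional, so resetting entry \<open>k\<close> to \<open>undefined\<close> recovers the shorter
  one.\<close>

lemma indep_tuples_Suc:
  "bij_betw (\<lambda>(l, x). l(k := x)) (SIGMA l:indep_tuples k. E - closure (l ` {..<k}))
     (indep_tuples (Suc k))"
proof (rule bij_betw_byWitness[where f' = "\<lambda>l. (l(k := undefined), l k)"])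
  show "\<forall>a\<in>(SIGMA l:indep_tuples k. E - closure (l ` {..<k})).
      (\<lambda>l. (l(k := undefined), l k)) ((\<lambda>(l, x). l(k := x)) a) = a"
    by (auto simp: indep_tuples_def PiE_def extensional_def fun_eq_iff)
  show "\<forall>a'\<in>indep_tuples (Suc k).
      (\<lambda>(l, x). l(k := x)) ((\<lambda>l. (l(k := undefined), l k)) a') = a'"
    by auto
  show "(\<lambda>(l, x). l(k := x)) ` (SIGMA l:indep_tuples k. E - closure (l ` {..<k}))
      \<subseteq> indep_tuples (Suc k)"
  proof clarify
    fix l x assume l: "l \<in> indep_tuples k" and x: "x \<in> E" "x \<notin> closure (l ` {..<k})"
    have img: "l(k := x) ` {..<Suc k} = insert x (l ` {..<k})"
      by (auto simp: lessThan_Suc)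
    have "inj_on (l(k := x)) {..<Suc k}"
      using l x by (auto simp: indep_tuples_def lessThan_Suc inj_on_def closure_def)
    moreover have "l(k := x) \<in> {..<Suc k} \<rightarrow>\<^sub>E E"
      using l x by (auto simp: indep_tuples_def PiE_def Pi_def extensional_def less_Suc_eq)
    ultimately show "l(k := x) \<in> indep_tuples (Suc k)"
      unfolding indep_tuples_def using x img by (simp add: closure_def)
  qed
  show "(\<lambda>l. (l(k := undefined), l k)) ` indep_tuples (Suc k)
      \<subseteq> (SIGMA l:indep_tuples k. E - closure (l ` {..<k}))"
  proof clarify
    fix l assume l: "l \<in> indep_tuples (Suc k)"
    have img: "l ` {..<Suc k} = insert (l k) (l ` {..<k})" "l(k := undefined) ` {..<k} = l ` {..<k}"
      by (auto simp: lessThan_Suc)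
    have inj: "inj_on l (insert k {..<k})"
      using l by (simp add: indep_tuples_def lessThan_Suc)
    then have "inj_on (l(k := undefined)) {..<k}" "l k \<notin> l ` {..<k}"
      by (auto simp: inj_on_def)
    moreover have "l(k := undefined) \<in> {..<k} \<rightarrow>\<^sub>E E" "l k \<in> E"
      using l by (auto simp: indep_tuples_def PiE_def Pi_def extensional_def)
    moreover have "indep (insert (l k) (l ` {..<k}))" "indep (l ` {..<k})"
      using l img indep_subset by (auto simp: indep_tuples_def)
    ultimately show "l(k := undefined) \<in> indep_tuples k \<and> l k \<in> E - closure (l(k := undefined) ` {..<k})"
      by (simp add: indep_tuples_def closure_def img)
  qed
qed

text \<open>
  If the elements of a tuple are drawn one after the other with probability proportional to \<open>g\<close>,
  then the \<open>k\<close>-th one lies in the closure of the preceding ones with probability at most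
  \<open>k / d\<close>; so independence survives each step with probability at least \<open>1 / d\<close>.
\<close>
lemma power_sum_le_indep_tuples:
  fixes g :: "'b \<Rightarrow> real"
  assumes g_nonneg: "\<And>x. x \<in> E \<Longrightarrow> 0 \<le> g x"
    and polytope: "\<And>F k. \<lbrakk>F \<subseteq> E; \<And>B. B \<in> BB \<Longrightarrow> card (B \<inter> F) \<le> k\<rbrakk> \<Longrightarrow>
      real d * sum g F \<le> real k * sum g E"
    and BB: "BB \<noteq> {}" and "k \<le> d"
  shows "sum g E ^ k \<le> real d ^ k * (\<Sum>l\<in>indep_tuples k. \<Prod>i<k. g (l i))"
  using \<open>k \<le> d\<close>
proof (induction k)
  case 0
  \<comment> \<open>The empty tuple is independent only because some base exists.\<close>
  have "indep_tuples 0 = {\<lambda>_. undefined}"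
    using BB by (auto simp: indep_tuples_def indep_def)
  then show ?case by simp
next
  case (Suc k)
  have step: "sum g E \<le> real d * sum g (E - closure (l ` {..<k}))" if l: "l \<in> indep_tuples k" for l
  proof -
    have ind: "indep (l ` {..<k})" and card: "card (l ` {..<k}) = k"
      using l by (auto simp: indep_tuples_def card_image)
    have sub: "closure (l ` {..<k}) \<subseteq> E" by (auto simp: closure_def)
    have "real d * sum g (closure (l ` {..<k})) \<le> real k * sum g E"
      using card_base_Int_closure[OF ind] card by (intro polytope sub) simp
    \<comment> \<open>Here \<open>k\<close> is at most \<open>d - 1\<close>, so at every step at
      least the fraction \<open>1 / d\<close> of the total weight lies outside the closure.\<close>
    moreover have "real k * sum g E \<le> (real d - 1) * sum g E"
      using Suc.prems by (intro mult_right_mono sum_nonneg g_nonneg) auto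
    moreover have "real d * sum g (E - closure (l ` {..<k}))
        = real d * sum g E - real d * sum g (closure (l ` {..<k}))"
      using sub finite_ground by (simp add: sum_diff right_diff_distrib)
    ultimately show ?thesis by (simp add: left_diff_distrib)
  qed
  have "sum g E ^ Suc k \<le> (real d ^ k * (\<Sum>l\<in>indep_tuples k. \<Prod>i<k. g (l i))) * sum g E"
    unfolding power_Suc2 using Suc by (intro mult_right_mono sum_nonneg g_nonneg) auto
  also have "\<dots> = real d ^ k * (\<Sum>l\<in>indep_tuples k. (\<Prod>i<k. g (l i)) * sum g E)"
    by (simp add: sum_distrib_right)
  also have "\<dots> \<le> real d ^ k * (\<Sum>l\<in>indep_tuples k.
      (\<Prod>i<k. g (l i)) * (real d * sum g (E - closure (l ` {..<k}))))"
    by (intro mult_left_mono sum_mono step prod_nonneg g_nonneg)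
      (auto simp: indep_tuples_def)
  also have "\<dots> = real d ^ Suc k * (\<Sum>l\<in>indep_tuples k.
      \<Sum>x\<in>E - closure (l ` {..<k}). (\<Prod>i<k. g (l i)) * g x)"
    by (simp add: sum_distrib_left mult_ac)
  also have "(\<Sum>l\<in>indep_tuples k. \<Sum>x\<in>E - closure (l ` {..<k}). (\<Prod>i<k. g (l i)) * g x)
      = (\<Sum>(l, x)\<in>(SIGMA l:indep_tuples k. E - closure (l ` {..<k})). (\<Prod>i<k. g (l i)) * g x)"
    using finite_indep_tuples finite_ground by (intro sum.Sigma) auto
  also have "\<dots> = (\<Sum>l\<in>indep_tuples (Suc k). \<Prod>i<Suc k. g (l i))"
    by (intro sum.reindex_bij_betw[OF indep_tuples_Suc, THEN trans[rotated]] sum.cong)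
      auto
  finally show ?case .
qed

lemma image_is_base:
  assumes "l \<in> indep_tuples d"
  shows "l ` {..<d} \<in> BB"
proof -
  obtain B where B: "B \<in> BB" "l ` {..<d} \<subseteq> B" and "card (l ` {..<d}) = d"
    using assms by (auto simp: indep_tuples_def indep_def card_image)
  then have "l ` {..<d} = B"
    using base_card finite_base by (intro card_subset_eq) auto
  then show ?thesis using B by simp
qed

definition base_tuples :: "(nat \<Rightarrow> 'b) set"
  where "base_tuples = {l \<in> {..<d} \<rightarrow>\<^sub>E E. inj_on l {..<d} \<and> l ` {..<d} \<in> BB}"

lemma indep_tuples_eq_base_tuples: "indep_tuples d = base_tuples"
  using image_is_base by (auto simp: base_tuples_def indep_tuples_def indep_def)

section \<open>Minimal weights and tight bases\<close>

lemma minimizer_exists: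
  fixes f :: "'b \<Rightarrow> real"
  assumes f_pos: "\<And>x. x \<in> E \<Longrightarrow> 0 < f x"
  defines "feasible \<equiv> \<lambda>S. (\<forall>x\<in>E. 0 \<le> S x) \<and> (\<forall>B\<in>BB. 1 \<le> prod S B)"
  obtains S where "feasible S"
    and "\<And>S'. feasible S' \<Longrightarrow> (\<Sum>x\<in>E. f x * S x) \<le> (\<Sum>x\<in>E. f x * S' x)"
proof -
  \<comment> \<open>The feasible region is unbounded. Up to values off \<open>E\<close>, which are
    pinned to 0, this box contains the weight 1 and every feasible weight that costs no more than
    it. It is compact as a product of compact intervals.\<close>
  define box where "box = PiE UNIV (\<lambda>x. {0 .. if x \<in> E then sum f E / f x else 0})"
  define K where "K = box \<inter> (\<Inter>B\<in>BB. {S. 1 \<le> prod S B})"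
  have "compactin (product_topology (\<lambda>_. euclidean) UNIV) box"
    unfolding box_def compactin_PiE by auto
  then have "compact box"
    by (simp add: euclidean_product_topology compactin_euclidean_iff)
  moreover have "closed (\<Inter>B\<in>BB. {S :: 'b \<Rightarrow> real. 1 \<le> prod S B})"
    by (intro closed_INT ballI closed_Collect_le continuous_intros continuous_on_product_coordinates)
  ultimately have "compact K" unfolding K_def by (rule compact_Int_closed)
  moreover have "(\<lambda>x. if x \<in> E then 1 else 0) \<in> K" (is "?one \<in> K")
  proof -
    have "1 \<le> sum f E / f x" if "x \<in> E" for x
      using member_le_sum[OF that, of f] f_pos finite_ground that by (simp add: less_imp_le)
    moreover have "prod ?one B = 1" if "B \<in> BB" for B
      using base_subset[OF that] by (intro prod.neutral) auto
    ultimately show ?thesis by (auto simp: K_def box_def PiE_def Pi_def)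
  qed
  moreover have "continuous_on K (\<lambda>S. \<Sum>x\<in>E. f x * S x)"
    by (intro continuous_intros continuous_on_subset[OF continuous_on_product_coordinates subset_UNIV])
  ultimately obtain S where S: "S \<in> K" and min: "\<And>S'. S' \<in> K \<Longrightarrow> (\<Sum>x\<in>E. f x * S x) \<le> (\<Sum>x\<in>E. f x * S' x)"
    using continuous_attains_inf[of K "\<lambda>S. \<Sum>x\<in>E. f x * S x"] by blast
  show thesis
  proof
    show "feasible S" using S by (auto simp: feasible_def K_def box_def PiE_def Pi_def)
    fix S' assume S': "feasible S'"
    show "(\<Sum>x\<in>E. f x * S x) \<le> (\<Sum>x\<in>E. f x * S' x)"
    proof (cases "(\<Sum>x\<in>E. f x * S' x) \<le> sum f E")
      case True
      define S'' where "S'' = (\<lambda>x. if x \<in> E then S' x else 0)"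
      have "S' x \<le> sum f E / f x" if x: "x \<in> E" for x
      proof -
        have "f x * S' x \<le> (\<Sum>x\<in>E. f x * S' x)"
          using S' f_pos by (intro member_le_sum x finite_ground) (auto simp: feasible_def less_imp_le)
        then show ?thesis using True f_pos[OF x] by (simp add: field_simps)
      qed
      moreover have "prod S'' B = prod S' B" if "B \<in> BB" for B
        using base_subset[OF that] by (intro prod.cong) (auto simp: S''_def)
      ultimately have "S'' \<in> K"
        using S' by (auto simp: K_def box_def PiE_def Pi_def S''_def feasible_def)
      then show ?thesis using min[of S''] by (simp add: S''_def)
    next
      \<comment> \<open>A weight costing more than \<open>sum f E\<close> loses to the weight 1,
        which lies in \<open>K\<close>.\<close>
      case False
      then show ?thesis using min[OF \<open>?one \<in> K\<close>] by simp
    qed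
  qed
qed

text \<open>This is the first-order optimality condition along the perturbation \<open>T\<close>.
  When the total of \<open>f x * S x\<close> is positive, it puts this function, rescaled to total
  \<open>d\<close>, into the base polytope of the tight bases.\<close>

lemma minimizer_polytope:
  fixes f S :: "'b \<Rightarrow> real"
  defines "feasible \<equiv> \<lambda>S. (\<forall>x\<in>E. 0 \<le> S x) \<and> (\<forall>B\<in>BB. 1 \<le> prod S B)"
  assumes S: "feasible S"
    and min: "\<And>S'. feasible S' \<Longrightarrow> (\<Sum>x\<in>E. f x * S x) \<le> (\<Sum>x\<in>E. f x * S' x)"
    and F: "F \<subseteq> E" and k: "\<And>B. B \<in> BB \<Longrightarrow> prod S B = 1 \<Longrightarrow> card (B \<inter> F) \<le> k"
  shows "real d * (\<Sum>x\<in>F. f x * S x) \<le> real k * (\<Sum>x\<in>E. f x * S x)"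
proof -
  \<comment> \<open>On a tight base \<open>B\<close> these exponents sum to
    \<open>d * (k - card (B \<inter> F))\<close>, which is nonnegative by the choice of
    \<open>k\<close>.\<close>
  define c where "c x = real k - (if x \<in> F then real d else 0)" for x
  define T where "T t x = S x * exp (t * c x)" for t x
  define h where "h t = (\<Sum>x\<in>E. f x * T t x)" for t
  have T0: "T 0 = S" by (simp add: T_def fun_eq_iff)
  have prod_T: "prod (T t) B = prod S B * exp (t * sum c B)" for t B
    by (cases "finite B") (auto simp: T_def prod.distrib exp_sum sum_distrib_left)
  have c_nonneg: "0 \<le> sum c B" if "B \<in> BB" "prod S B = 1" for B
  proof -
    have "sum c B = real d * real k - real d * real (card (B \<inter> F))"
      using finite_base[OF that(1)] base_card[OF that(1)]
      by (simp add: c_def sum_subtractf sum.If_cases)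
    moreover have "real d * real (card (B \<inter> F)) \<le> real d * real k"
      using k[OF that] by (intro mult_left_mono) auto
    ultimately show ?thesis by simp
  qed
  have "\<forall>\<^sub>F t in at_right 0. 1 \<le> prod (T t) B" if B: "B \<in> BB" for B
  proof (cases "prod S B = 1")
    case True
    show ?thesis
      using eventually_at_right_less[of 0] by eventually_elim (simp add: prod_T True c_nonneg B)
  next
    case False
    \<comment> \<open>A base that is not tight has strict slack, which survives for small
      \<open>t\<close> by continuity.\<close>
    then have gt: "1 < prod S B" using S B by (force simp: feasible_def)
    have "((\<lambda>t. prod S B * exp (t * sum c B)) \<longlongrightarrow> prod S B * exp (0 * sum c B)) (at_right 0)"
      by (intro tendsto_intros)
    then have "\<forall>\<^sub>F t in at_right 0. 1 < prod S B * exp (t * sum c B)"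
      using gt by (intro order_tendstoD(1)) auto
    then show ?thesis by eventually_elim (simp add: prod_T)
  qed
  \<comment> \<open>Since there are finitely many bases, one range of \<open>t\<close> serves them
    all.\<close>
  moreover have "finite BB"
    using base_subset finite_ground by (intro finite_subset[of BB "Pow E"]) auto
  ultimately have "\<forall>\<^sub>F t in at_right 0. \<forall>B\<in>BB. 1 \<le> prod (T t) B"
    by (simp add: eventually_ball_finite)
  then have "\<forall>\<^sub>F t in at_right 0. h 0 \<le> h t"
  proof eventually_elim
    case (elim t)
    then have "feasible (T t)" using S by (simp add: feasible_def T_def)
    from min[OF this] show ?case by (simp add: h_def T0)
  qed
  then obtain e where e: "0 < e" "\<And>t. t \<in> {0<..} \<Longrightarrow> t \<noteq> 0 \<and> dist t 0 < e \<Longrightarrow> h 0 \<le> h t"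
    unfolding eventually_at by metis
  have deriv: "(h has_real_derivative (\<Sum>x\<in>E. f x * S x * c x)) (at 0)"
    unfolding h_def
  proof (rule DERIV_sum)
    show "((\<lambda>t. f x * T t x) has_real_derivative f x * S x * c x) (at 0)" for x
      unfolding T_def by (auto intro!: derivative_eq_intros)
  qed
  \<comment> \<open>The perturbation is feasible only to the right of 0, so minimality yields an
    inequality for the derivative, not its vanishing.\<close>
  have "0 \<le> (\<Sum>x\<in>E. f x * S x * c x)"
  proof (rule ccontr)
    assume "\<not> ?thesis"
    then obtain e' where e': "0 < e'" "\<And>t. 0 < t \<Longrightarrow> t < e' \<Longrightarrow> h t < h 0"
      using DERIV_neg_dec_right[OF deriv] by auto
    obtain t where "0 < t" "t < min e e'" using dense[of 0 "min e e'"] e(1) e'(1) by auto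
    then show False using e(2)[of t] e'(2)[of t] by simp
  qed
  also have "\<dots> = real k * (\<Sum>x\<in>E. f x * S x) - real d * (\<Sum>x\<in>E \<inter> F. f x * S x)"
  proof -
    have "f x * S x * c x = real k * (f x * S x) - (if x \<in> F then real d * (f x * S x) else 0)" for x
      by (simp add: c_def algebra_simps)
    then show ?thesis
      using finite_ground
      by (simp only: sum_subtractf sum_distrib_left) (simp only: sum.inter_restrict)
  qed
  finally show ?thesis using F by (simp add: Int_absorb1)
qed

text \<open>A symmetric exchange only redistributes the elements of the two bases, so the new
  products again multiply to 1. Both are at least 1, hence both equal 1.\<close>

lemma tight_bases:
  fixes S :: "'b \<Rightarrow> real"
  assumes "\<And>B. B \<in> BB \<Longrightarrow> 1 \<le> prod S B"
  shows "matroid_bases E d {B\<in>BB. prod S B = 1}"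
proof
  fix A B x assume A: "A \<in> {B\<in>BB. prod S B = 1}" and B: "B \<in> {B\<in>BB. prod S B = 1}"
    and x: "x \<in> A - B"
  then obtain y where y: "y \<in> B - A" and A': "insert y (A - {x}) \<in> BB" and B': "insert x (B - {y}) \<in> BB"
    using symmetric_exchange by blast
  have fin: "finite A" "finite B" using A B finite_base by auto
  have "prod S (insert y (A - {x})) * prod S (insert x (B - {y})) = prod S A * prod S B"
    using x y fin by (simp add: prod.remove[of A x] prod.remove[of B y])
  also have "\<dots> = 1" using A B by simp
  finally have *: "prod S (insert y (A - {x})) * prod S (insert x (B - {y})) = 1" .
  have "p = 1 \<and> q = 1" if "1 \<le> p" "1 \<le> q" "p * q = 1" for p q :: real
    using that by (smt (verit) mult_less_cancel_left1 mult_less_cancel_right1)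
  from this[OF assms[OF A'] assms[OF B'] *]
  show "\<exists>y\<in>B - A. insert y (A - {x}) \<in> {B\<in>BB. prod S B = 1} \<and>
      insert x (B - {y}) \<in> {B\<in>BB. prod S B = 1}"
    using y A' B' by blast
qed (use finite_ground base_subset base_card in auto)

theorem weighted_bases:
  fixes f :: "'b \<Rightarrow> real"
  assumes f_pos: "\<And>x. x \<in> E \<Longrightarrow> 0 < f x" and d: "1 \<le> d"
  shows "\<exists>S. (\<forall>x\<in>E. 0 \<le> S x) \<and> (\<forall>B\<in>BB. 1 \<le> prod S B) \<and>
    (\<Sum>x\<in>E. f x * S x) \<le> d * (\<Sum>l\<in>base_tuples. \<Prod>i<d. f (l i)) powr (1 / d)"
proof -
  obtain S where S: "\<forall>x\<in>E. 0 \<le> S x" "\<forall>B\<in>BB. 1 \<le> prod S B"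
    and min: "\<And>S'. (\<forall>x\<in>E. 0 \<le> S' x) \<and> (\<forall>B\<in>BB. 1 \<le> prod S' B) \<Longrightarrow>
      (\<Sum>x\<in>E. f x * S x) \<le> (\<Sum>x\<in>E. f x * S' x)"
    by (rule minimizer_exists[of f, OF f_pos]) blast+
  define g where "g x = f x * S x" for x
  define T where "T = (\<Sum>l\<in>base_tuples. \<Prod>i<d. f (l i))"
  have g_nonneg: "0 \<le> g x" if "x \<in> E" for x using that S f_pos by (simp add: g_def less_imp_le)
  have f_prod_nonneg: "0 \<le> (\<Prod>i<d. f (l i))" if "l \<in> base_tuples" for l
    using that by (intro prod_nonneg) (auto simp: base_tuples_def intro!: less_imp_le f_pos)
  then have T_nonneg: "0 \<le> T" unfolding T_def by (rule sum_nonneg)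
  interpret tight: matroid_bases E d "{B\<in>BB. prod S B = 1}"
    by (rule tight_bases) (use S in blast)
  have polytope: "real d * sum g F \<le> real k * sum g E"
    if "F \<subseteq> E" "\<And>B. B \<in> {B\<in>BB. prod S B = 1} \<Longrightarrow> card (B \<inter> F) \<le> k" for F k
    unfolding g_def by (rule minimizer_polytope) (use S min that in auto)
  have bound: "sum g E \<le> d * T powr (1 / d)"
  proof (cases "sum g E \<le> 0")
    case True
    then show ?thesis by (rule order_trans) simp
  next
    case False
    \<comment> \<open>Without tight bases the polytope inequality would hold for
      \<open>F = E\<close> and \<open>k = 0\<close>, against the positive total weight.\<close>
    have "{B\<in>BB. prod S B = 1} \<noteq> {}"
    proof
      assume none: "{B\<in>BB. prod S B = 1} = {}"
      have "real d * sum g E \<le> real 0 * sum g E"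
        by (rule polytope) (use none in auto)
      then show False using False d by (simp add: mult_le_0_iff)
    qed
    then have "sum g E ^ d \<le> real d ^ d * (\<Sum>l\<in>tight.indep_tuples d. \<Prod>i<d. g (l i))"
      by (intro tight.power_sum_le_indep_tuples g_nonneg polytope) auto
    also have "(\<Sum>l\<in>tight.indep_tuples d. \<Prod>i<d. g (l i)) = (\<Sum>l\<in>tight.base_tuples. \<Prod>i<d. f (l i))"
      unfolding tight.indep_tuples_eq_base_tuples
    proof (rule sum.cong)
      fix l assume l: "l \<in> tight.base_tuples"
      then have inj: "inj_on l {..<d}" by (simp add: tight.base_tuples_def)
      \<comment> \<open>Along a tight base the weights multiply to 1, so \<open>g\<close> can be
        traded for \<open>f\<close>, which does not involve the minimiser.\<close>
      have "(\<Prod>i<d. S (l i)) = prod S (l ` {..<d})"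
        by (simp add: prod.reindex[OF inj])
      also have "\<dots> = 1" using l by (simp add: tight.base_tuples_def)
      finally show "(\<Prod>i<d. g (l i)) = (\<Prod>i<d. f (l i))" by (simp add: g_def prod.distrib)
    qed simp
    also have "(\<Sum>l\<in>tight.base_tuples. \<Prod>i<d. f (l i)) \<le> T"
      unfolding T_def using finite_indep_tuples[of d] f_prod_nonneg
      by (intro sum_mono2) (auto simp: indep_tuples_eq_base_tuples base_tuples_def tight.base_tuples_def)
    \<comment> \<open>The case \<open>T = 0\<close> is separate; there \<open>d \<ge> 1\<close> is
      what makes \<open>0 ^ d\<close> vanish.\<close>
    also have "T = (T powr (1 / d)) ^ d"
      using d T_nonneg powr_power[where z = T and u = "1 / real d" and n = d] by (cases "T = 0") (simp_all add: zero_power)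
    finally have "sum g E ^ d \<le> (d * T powr (1 / d)) ^ d"
      by (simp add: power_mult_distrib mult_left_mono)
    then show ?thesis using power_le_imp_le_base[of "sum g E" "d - 1"] d by simp
  qed
  then show ?thesis using S by (auto simp: g_def T_def)
qed

end

section \<open>Lines through the origin\<close>

context vectorspace
begin

lemma lin_indpt_singleton:
  assumes "u \<in> carrier V" and "u \<noteq> \<zero>\<^bsub>V\<^esub>"
  shows "lin_indpt {u}"
proof -
  have "lin_indpt {}" by (simp add: lin_dep_def)
  then show ?thesis
    using lin_dep_iff_in_span[of "{}" u] assms by (simp add: span_empty)
qed

text \<open>A smallest \<open>D \<subseteq> B\<close> with \<open>x\<close> in its span is not
  contained in \<open>W\<close>, and by minimality each of its elements can be traded for
  \<open>x\<close>. Choosing \<open>b\<close> outside \<open>W\<close> is what later makes the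
  exchange symmetric. If \<open>x\<close> lies in \<open>B\<close>, then
  \<open>b = x\<close>.\<close>

lemma basis_exchange_avoiding:
  assumes B: "basis B" "finite B" and x: "x \<in> carrier V" "x \<notin> W" and W: "submodule K W V"
  obtains b where "b \<in> B" "b \<notin> W" "x \<notin> B - {b}" "basis (insert x (B - {b}))"
proof -
  have BV: "B \<subseteq> carrier V" and ind: "lin_indpt B" and gen: "x \<in> span B"
    using B x by (auto simp: basis_def)
  define P where "P D \<longleftrightarrow> D \<subseteq> B \<and> x \<in> span D" for D
  obtain D where D: "P D" and min: "\<And>D'. P D' \<Longrightarrow> card D \<le> card D'"
    using gen ex_has_least_nat[of P B card] by (auto simp: P_def)
  have DB: "D \<subseteq> B" and xD: "x \<in> span D" using D by (auto simp: P_def)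
  have "\<not> D \<subseteq> W" using span_is_subset[OF _ W] xD x by blast
  then obtain b where b: "b \<in> D" "b \<notin> W" by blast
  have bB: "b \<in> B" using b DB by blast
  have "\<not> P (D - {b})"
    using min[of "D - {b}"] b card_Diff1_less[of D b] finite_subset[OF DB B(2)] by force
  then have xDb: "x \<notin> span (D - {b})" using DB by (auto simp: P_def)
  have DbV: "D - {b} \<subseteq> carrier V" using DB BV by auto
  have indDb: "lin_indpt (D - {b})" using subset_li_is_li[OF ind] DB by blast
  have xnot: "x \<notin> D - {b}" using xDb in_own_span[OF DbV] by blast
  have ind': "lin_indpt (insert x (D - {b}))"
    using lin_dep_iff_in_span[OF DbV indDb x(1) xnot] xDb by simp
  \<comment> \<open>Adding \<open>x\<close> to \<open>D\<close> creates a dependence that is absent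
    without \<open>b\<close>, so \<open>b\<close> can be solved for.\<close>
  have "b \<in> span (insert x (D - {b}))"
  proof (cases "b = x")
    case True
    then show ?thesis using in_own_span[of "insert x (D - {b})"] DbV x by auto
  next
    case False
    have "lin_dep (insert x D)"
      using xD lin_dep_iff_in_span[of D x] DB BV ind subset_li_is_li[of B D] x xnot False by auto
    moreover have "insert x D = insert x (D - {b}) \<union> {b}" using b by auto
    ultimately show ?thesis
      using lin_dep_iff_in_span[of "insert x (D - {b})" b] ind' DbV x False bB BV by auto
  qed
  then have bspan: "b \<in> span (insert x (B - {b}))"
    using span_is_monotone[of "insert x (D - {b})" "insert x (B - {b})"] DB by blast
  have bnot: "b \<notin> span (B - {b})"
    using ind bB lindep_span[OF BV B(2)] by blast
  have "x \<notin> B - {b}"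
    using bspan bnot by (metis insert_absorb)
  moreover have "basis (insert x (B - {b}))"
    using basis_swap[of "B - {b}" b x] B BV bB x bspan by (auto simp: insert_absorb)
  ultimately show thesis using that b bB by blast
qed

text \<open>The value of \<open>dim\<close> becomes usable once \<open>L\<close> has a finite basis.
  A maximal independent subset provides one, since independent subsets of \<open>L\<close> stay
  independent in \<open>V\<close> and so have bounded size.\<close>

lemma subspace_dim_1_span:
  assumes fin: "fin_dim" and L: "VectorSpace.subspace K L V" and dim: "vectorspace.dim K (vs L) = 1"
  shows "\<exists>u\<in>L. u \<noteq> \<zero>\<^bsub>V\<^esub>"
    and "\<And>u w. \<lbrakk>u \<in> L; u \<noteq> \<zero>\<^bsub>V\<^esub>; w \<in> L\<rbrakk> \<Longrightarrow> w \<in> span {u}"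
proof -
  have sub: "submodule K L V" and LV: "L \<subseteq> carrier V"
    using is_module[OF L] submodule.subset by auto
  interpret L: vectorspace K "vs L" by (rule subspace_is_vs[OF L])
  have span_eq: "L.span S = span S" and dep_eq: "L.lin_dep S = lin_dep S" if "S \<subseteq> L" for S
    using span_li_not_depend[OF that sub] by auto
  have "finite S \<and> card S \<le> dim" if "S \<subseteq> carrier (vs L) \<and> L.lin_indpt S" for S
    using that li_le_dim[OF fin, of S] dep_eq[of S] LV by auto
  moreover have "{} \<subseteq> carrier (vs L) \<and> L.lin_indpt {}" by (simp add: L.lin_dep_def)
  ultimately obtain S where S: "finite S" "maximal S (\<lambda>S. S \<subseteq> carrier (vs L) \<and> L.lin_indpt S)"
    using maximal_exists[of "\<lambda>S. S \<subseteq> carrier (vs L) \<and> L.lin_indpt S" dim "{}"] by blast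
  then have basis: "L.basis S" by (intro L.max_li_is_basis)
  then have finL: "L.fin_dim" using S by (auto simp: L.fin_dim_def L.basis_def)
  have "card S = 1" using L.dim_basis[OF S(1) basis] dim by simp
  then obtain a where a: "S = {a}" by (auto simp: card_1_singleton_iff)
  have "\<zero>\<^bsub>V\<^esub> \<notin> S"
    using basis L.vs_zero_lin_dep[of S] by (auto simp: L.basis_def)
  then show "\<exists>u\<in>L. u \<noteq> \<zero>\<^bsub>V\<^esub>" using a basis by (auto simp: L.basis_def)
  fix u w assume u: "u \<in> L" "u \<noteq> \<zero>\<^bsub>V\<^esub>" and w: "w \<in> L"
  have "L.lin_indpt {u}" using u dep_eq[of "{u}"] lin_indpt_singleton[of u] LV by auto
  then have "L.basis {u}" using L.dim_li_is_basis[OF finL, of "{u}"] u dim by simp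
  then show "w \<in> span {u}" using w span_eq[of "{u}"] u by (auto simp: L.basis_def)
qed

end

section \<open>Dimension of the coordinate space\<close>

locale coordinate_space = vectorspace F "coord_space F d"
  for F :: "('a, 'm) ring_scheme" and d :: nat
begin

lemma unit_vectors_span:
  obtains U where "finite U" "card U \<le> d" "U \<subseteq> carrier (coord_space F d)"
    "span U = carrier (coord_space F d)"
proof -
  define e where "e i = (\<lambda>j\<in>{..<d}. if j = i then \<one>\<^bsub>F\<^esub> else \<zero>\<^bsub>F\<^esub>)" for i
  define U where "U = e ` {..<d}"
  have U: "U \<subseteq> carrier (coord_space F d)" by (auto simp: U_def e_def func_space_def split: if_splits)
  then have sub: "submodule F (span U) (coord_space F d)" by (rule span_is_submodule)
  \<comment> \<open>Induction on the number \<open>k\<close> of leading coordinates that may be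
    nonzero; each step splits off a multiple of one unit vector.\<close>
  have "x \<in> span U" if "x \<in> carrier (coord_space F d)" "k \<le> d" "\<And>i. k \<le> i \<Longrightarrow> i < d \<Longrightarrow> x i = \<zero>\<^bsub>F\<^esub>" for k x
    using that
  proof (induction k arbitrary: x)
    case 0
    then have "x = \<zero>\<^bsub>coord_space F d\<^esub>"
      by (auto simp: func_space_def fun_eq_iff PiE_def extensional_def)
    then show ?case using sub by (simp add: submodule.zero_closed)
  next
    case (Suc k)
    define y where "y = (\<lambda>j\<in>{..<d}. if j = k then \<zero>\<^bsub>F\<^esub> else x j)"
    have xF: "x j \<in> carrier F" if "j < d" for j
      using Suc.prems(1) that by (auto simp: func_space_def)
    have "y \<in> span U"
    proof (rule Suc.IH)
      show "y \<in> carrier (coord_space F d)" using xF by (auto simp: y_def func_space_def)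
      show "y i = \<zero>\<^bsub>F\<^esub>" if "k \<le> i" "i < d" for i
        using that Suc.prems(3)[of i] by (auto simp: y_def)
    qed (use Suc.prems in simp)
    moreover have "e k \<in> span U" using in_own_span[OF U] Suc.prems by (auto simp: U_def)
    moreover have "x = y \<oplus>\<^bsub>coord_space F d\<^esub> (x k \<odot>\<^bsub>coord_space F d\<^esub> e k)"
      using Suc.prems xF
      by (auto simp: func_space_def fun_eq_iff PiE_def extensional_def y_def e_def)
    ultimately show ?case
      using sub xF[of k] Suc.prems by (metis Suc_le_lessD submodule.m_closed submodule.smult_closed)
  qed
  from this[of _ d] have "span U = carrier (coord_space F d)"
    using span_is_subset2[OF U] by auto
  moreover have "card U \<le> d" using card_image_le[of "{..<d}" e] by (simp add: U_def)
  ultimately show thesis using that[of U] U by (simp add: U_def)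
qed

lemma fin_dim: "fin_dim" and dim_le: "dim \<le> d"
  by (rule unit_vectors_span; use gen_ge_dim in \<open>force simp: fin_dim_def\<close>)+

lemma basis_if_card:
  assumes "A \<subseteq> carrier (coord_space F d)" "finite A" "lin_indpt A" "card A = d"
  shows "basis A"
  using dim_li_is_basis[OF fin_dim] assms dim_le by simp

section \<open>The matroid of lines\<close>

lemma line_subset: "L \<in> lines0 F d \<Longrightarrow> L \<subseteq> carrier (coord_space F d)"
  using submodule.subset[OF is_module] by (auto simp: lines0_def)

lemma line_nonzero: "L \<in> lines0 F d \<Longrightarrow> \<exists>u\<in>L. u \<noteq> \<zero>\<^bsub>coord_space F d\<^esub>"
  using subspace_dim_1_span(1)[OF fin_dim, of L] by (simp add: lines0_def)

lemma line_span:
  "\<lbrakk>L \<in> lines0 F d; u \<in> L; u \<noteq> \<zero>\<^bsub>coord_space F d\<^esub>; w \<in> L\<rbrakk> \<Longrightarrow> w \<in> span {u}"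
  using subspace_dim_1_span(2)[OF fin_dim, of L] by (simp add: lines0_def)

text \<open>Direction vectors are indexed by the lines themselves, so that exchanging a line becomes
  a function update.\<close>

definition directions :: "(nat \<Rightarrow> 'a) set set \<Rightarrow> ((nat \<Rightarrow> 'a) set \<Rightarrow> nat \<Rightarrow> 'a) \<Rightarrow> bool"
  where "directions A v \<longleftrightarrow> A \<subseteq> lines0 F d \<and> finite A \<and> card A = d \<and>
    (\<forall>L\<in>A. v L \<in> L \<and> v L \<noteq> \<zero>\<^bsub>coord_space F d\<^esub>) \<and> inj_on v A \<and> lin_indpt (v ` A)"

definition line_bases :: "(nat \<Rightarrow> 'a) set set set"
  where "line_bases = {A. \<exists>v. directions A v}"

lemma directions_carrier: "directions A v \<Longrightarrow> v ` A \<subseteq> carrier (coord_space F d)"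
  using line_subset by (fastforce simp: directions_def)

lemma directions_basis: "directions A v \<Longrightarrow> basis (v ` A)"
  using directions_carrier[of A v]
  by (intro basis_if_card) (auto simp: directions_def card_image)

text \<open>Carries an exchange of vectors over to lines: \<open>v\<close> is redefined at
  \<open>M\<close> to be \<open>y\<close>, which is nonzero because it belongs to an independent
  set.\<close>

lemma directions_replace:
  assumes A: "directions A v" and L: "L \<in> A" and M: "M \<in> lines0 F d" "M \<notin> A - {L}"
    and y: "y \<in> M" and ind: "y \<notin> v ` A - {v L}" "lin_indpt (insert y (v ` A - {v L}))"
  shows "insert M (A - {L}) \<in> line_bases"
proof -
  have inj: "inj_on v A" and fin: "finite A" using A by (auto simp: directions_def)
  have img: "v ` A - {v L} = v ` (A - {L})" using inj L by (auto simp: inj_on_def)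
  have sub: "insert y (v ` (A - {L})) \<subseteq> carrier (coord_space F d)"
    using directions_carrier[OF A] line_subset[OF M(1)] y by auto
  have "y \<noteq> \<zero>\<^bsub>coord_space F d\<^esub>"
    using vs_zero_lin_dep[OF sub] ind img by auto
  moreover have "(v(M := y)) ` insert M (A - {L}) = insert y (v ` (A - {L}))"
    using M by auto
  moreover have "inj_on (v(M := y)) (insert M (A - {L}))"
    using inj M ind(1) img by (auto simp: inj_on_def)
  moreover have "card (insert M (A - {L})) = card A"
    using M(2) L fin card_Suc_Diff1[OF fin L] by simp
  ultimately have "directions (insert M (A - {L})) (v(M := y))"
    unfolding directions_def using A M y ind img by (auto simp: directions_def)
  then show ?thesis by (auto simp: line_bases_def)
qed

lemma line_exchange:
  assumes A: "A \<in> line_bases" and B: "B \<in> line_bases" and L: "L \<in> A - B"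
  shows "\<exists>M\<in>B - A. insert M (A - {L}) \<in> line_bases \<and> insert L (B - {M}) \<in> line_bases"
proof -
  obtain v w where v: "directions A v" and w: "directions B w"
    using A B by (auto simp: line_bases_def)
  define W where "W = span (v ` A - {v L})"
  have Wsub: "v ` A - {v L} \<subseteq> carrier (coord_space F d)" using directions_carrier[OF v] by auto
  then have W: "submodule F W (coord_space F d)" unfolding W_def by (rule span_is_submodule)
  have indA: "lin_indpt (v ` A)" and fin: "finite (v ` A)" "finite (w ` B)"
    using v w by (auto simp: directions_def)
  have vL: "v L \<in> carrier (coord_space F d)" "v L \<in> v ` A" "v L \<notin> W"
    using L directions_carrier[OF v] indA lindep_span[OF directions_carrier[OF v] fin(1)]
    by (auto simp: W_def)
  obtain y where y: "y \<in> w ` B" "y \<notin> W" "v L \<notin> w ` B - {y}" "basis (insert (v L) (w ` B - {y}))"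
    by (rule basis_exchange_avoiding[OF directions_basis[OF w] fin(2) vL(1) vL(3) W])
  obtain M where M: "M \<in> B" "y = w M" using y by blast
  have MB: "M \<in> lines0 F d" "w M \<in> M" using w M by (auto simp: directions_def)
  \<comment> \<open>A common line \<open>M\<close> differs from \<open>L\<close>, so
    \<open>w M\<close> would be a multiple of \<open>v M\<close> and hence lie in
    \<open>W\<close>.\<close>
  have MA: "M \<notin> A"
  proof
    assume MA: "M \<in> A"
    then have "v M \<in> v ` A - {v L}"
      using v L M by (auto simp: directions_def inj_on_def)
    then have "span {v M} \<subseteq> W" unfolding W_def by (intro span_is_monotone) simp
    moreover have "w M \<in> span {v M}"
      using line_span[OF MB(1) _ _ MB(2), of "v M"] v MA by (auto simp: directions_def)
    ultimately show False using y M by auto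
  qed
  have "y \<notin> v ` A - {v L}" using in_own_span[OF Wsub] y by (auto simp: W_def)
  moreover have "lin_indpt (insert y (v ` A - {v L}))"
    using lin_dep_iff_in_span[OF Wsub _ _ \<open>y \<notin> v ` A - {v L}\<close>] subset_li_is_li[OF indA] y M
      directions_carrier[OF w] by (auto simp: W_def)
  ultimately have "insert M (A - {L}) \<in> line_bases"
    using directions_replace[OF v _ MB(1), of L y] L MA MB M by auto
  moreover have "insert L (B - {M}) \<in> line_bases"
    using directions_replace[OF w M(1), of L "v L"] y M L v
    by (auto simp: directions_def basis_def)
  ultimately show ?thesis using M MA by blast
qed

text \<open>Ordinary exchange, obtained by avoiding only the zero subspace.\<close>

lemma line_in_basis:
  assumes B: "B \<in> line_bases" and L: "L \<in> lines0 F d"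
  obtains M where "M \<in> B" "insert L (B - {M}) \<in> line_bases"
proof (cases "L \<in> B")
  case True
  then show thesis using that[of L] B by (simp add: insert_absorb)
next
  case False
  obtain w where w: "directions B w" using B by (auto simp: line_bases_def)
  obtain x where x: "x \<in> L" "x \<noteq> \<zero>\<^bsub>coord_space F d\<^esub>" using line_nonzero[OF L] by blast
  have zero: "submodule F {\<zero>\<^bsub>coord_space F d\<^esub>} (coord_space F d)"
    using span_is_submodule[of "{}"] by (simp add: span_empty)
  have fin: "finite (w ` B)" using w by (simp add: directions_def)
  have xV: "x \<in> carrier (coord_space F d)" "x \<notin> {\<zero>\<^bsub>coord_space F d\<^esub>}"
    using x line_subset[OF L] by auto
  obtain y where y: "y \<in> w ` B" "x \<notin> w ` B - {y}" "basis (insert x (w ` B - {y}))"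
    by (rule basis_exchange_avoiding[OF directions_basis[OF w] fin xV zero])
  then obtain M where M: "M \<in> B" "y = w M" by blast
  have "insert L (B - {M}) \<in> line_bases"
    by (rule directions_replace[OF w M(1) L _ x(1)]) (use y M False in \<open>simp_all add: basis_def\<close>)
  then show thesis using that M by blast
qed

section \<open>Weights on all lines\<close>

lemma delta_eq:
  assumes l: "\<And>i. i < d \<Longrightarrow> l i \<in> lines0 F d"
  shows "delta F d l = (if inj_on l {..<d} \<and> l ` {..<d} \<in> line_bases then 1 else 0)"
proof -
  \<comment> \<open>Independent directions force distinct lines, since two vectors on one line are
    proportional. This allows passing from tuples to sets of lines.\<close>
  have "inj_on l {..<d} \<and> l ` {..<d} \<in> line_bases"
    if v: "\<forall>i<d. v i \<in> l i \<and> v i \<noteq> \<zero>\<^bsub>coord_space F d\<^esub>" "inj_on v {..<d}" "lin_indpt (v ` {..<d})" for v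
  proof
    have vV: "v ` {..<d} \<subseteq> carrier (coord_space F d)" using v l line_subset by fastforce
    show inj: "inj_on l {..<d}"
    proof (rule inj_onI, rule ccontr)
      fix i j assume ij: "i \<in> {..<d}" "j \<in> {..<d}" "l i = l j" "i \<noteq> j"
      then have "v i \<in> span {v j}" using line_span[OF l, of j "v j" "v i"] v by auto
      moreover have "{v j} \<subseteq> v ` {..<d} - {v i}" using ij v(2) by (auto simp: inj_on_def)
      ultimately have "v i \<in> span (v ` {..<d} - {v i})" using span_is_monotone by blast
      then show False using lindep_span[OF vV] v(3) ij by blast
    qed
    have "directions (l ` {..<d}) (v \<circ> inv_into {..<d} l)"
      unfolding directions_def
    proof (intro conjI ballI)
      fix L assume "L \<in> l ` {..<d}"
      then obtain i where i: "i < d" "L = l i" by auto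
      then show "(v \<circ> inv_into {..<d} l) L \<in> L" "(v \<circ> inv_into {..<d} l) L \<noteq> \<zero>\<^bsub>coord_space F d\<^esub>"
        using v inj by (auto simp: inv_into_f_f)
    next
      show "inj_on (v \<circ> inv_into {..<d} l) (l ` {..<d})"
        using v(2) inj by (auto simp: inj_on_def inv_into_f_f)
      have "(v \<circ> inv_into {..<d} l) ` l ` {..<d} = v ` {..<d}"
        using inj by (auto simp: image_iff inv_into_f_f)
      then show "lin_indpt ((v \<circ> inv_into {..<d} l) ` l ` {..<d})" using v by simp
    qed (use l inj in \<open>auto simp: card_image\<close>)
    then show "l ` {..<d} \<in> line_bases" by (auto simp: line_bases_def)
  qed
  moreover have "\<exists>v. (\<forall>i<d. v i \<in> l i \<and> v i \<noteq> \<zero>\<^bsub>coord_space F d\<^esub>) \<and> inj_on v {..<d} \<and> lin_indpt (v ` {..<d})"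
    if inj: "inj_on l {..<d}" and base: "l ` {..<d} \<in> line_bases"
  proof -
    obtain v where "directions (l ` {..<d}) v" using base by (auto simp: line_bases_def)
    then show ?thesis using inj comp_inj_on[of l "{..<d}" v]
      by (intro exI[of _ "v \<circ> l"]) (auto simp: directions_def image_comp)
  qed
  ultimately show ?thesis unfolding delta_def by auto
qed

text \<open>The matroid bound handles the support \<open>E\<close> of \<open>f\<close>. Lines
  outside \<open>E\<close> cost nothing, so they may get a large weight that secures the constraints
  involving them, provided that the weights on \<open>E\<close> are bounded away from 0.\<close>

theorem line_weights:
  fixes f :: "(nat \<Rightarrow> 'a) set \<Rightarrow> real"
  assumes d: "1 \<le> d"
    and f_nonneg: "\<And>l. l \<in> lines0 F d \<Longrightarrow> 0 \<le> f l"
    and supp: "finite {l\<in>lines0 F d. f l \<noteq> 0}"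
    and nondegenerate: "(\<exists>l\<in>lines0 F d. f l \<noteq> 0) \<longrightarrow> delta_sum F d f \<noteq> 0"
  shows "\<exists>S :: (nat \<Rightarrow> 'a) set \<Rightarrow> real. (\<forall>l\<in>lines0 F d. 0 \<le> S l) \<and>
    (\<forall>l. (\<forall>i<d. l i \<in> lines0 F d) \<and> delta F d l = 1 \<longrightarrow> 1 \<le> (\<Prod>i<d. S (l i))) \<and>
    (\<Sum>\<^sub>\<infinity>l\<in>lines0 F d. S l * f l) \<le> d * delta_sum F d f powr (1 / d)"
proof -
  define E where "E = {l\<in>lines0 F d. f l \<noteq> 0}"
  have EL: "E \<subseteq> lines0 F d" and finE: "finite E" using supp by (auto simp: E_def)
  have infsum_eq: "(\<Sum>\<^sub>\<infinity>l\<in>lines0 F d. S l * f l) = (\<Sum>l\<in>E. f l * S l)" for S :: "(nat \<Rightarrow> 'a) set \<Rightarrow> real"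
  proof -
    have "(\<Sum>\<^sub>\<infinity>l\<in>lines0 F d. S l * f l) = (\<Sum>\<^sub>\<infinity>l\<in>E. f l * S l)"
      by (rule infsum_cong_neutral) (auto simp: E_def)
    then show ?thesis using finE by simp
  qed
  interpret matroid_bases E d "{A\<in>line_bases. A \<subseteq> E}"
  proof
    show "card B = d" if "B \<in> {A\<in>line_bases. A \<subseteq> E}" for B
      using that by (auto simp: line_bases_def directions_def)
    fix A B L
    assume A: "A \<in> {A\<in>line_bases. A \<subseteq> E}" and B: "B \<in> {A\<in>line_bases. A \<subseteq> E}" and L: "L \<in> A - B"
    then obtain M where "M \<in> B - A" "insert M (A - {L}) \<in> line_bases" "insert L (B - {M}) \<in> line_bases"
      using line_exchange by blast
    with A B L show "\<exists>M\<in>B - A. insert M (A - {L}) \<in> {A\<in>line_bases. A \<subseteq> E} \<and>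
        insert L (B - {M}) \<in> {A\<in>line_bases. A \<subseteq> E}"
      by blast
  qed (use finE in auto)
  have delta_sum_eq: "delta_sum F d f = (\<Sum>l\<in>base_tuples. \<Prod>i<d. f (l i))"
  proof -
    have "delta_sum F d f = (\<Sum>\<^sub>\<infinity>l\<in>base_tuples. \<Prod>i<d. f (l i))"
      unfolding delta_sum_def
    proof (rule infsum_cong_neutral)
      fix l assume l: "l \<in> ({..<d} \<rightarrow>\<^sub>E lines0 F d) - base_tuples"
      \<comment> \<open>A tuple inside the support that is not a base has \<open>delta\<close> 0;
        any other tuple has a vanishing factor of \<open>f\<close>.\<close>
      show "delta F d l * (\<Prod>i<d. f (l i)) = 0"
      proof (cases "\<forall>i<d. l i \<in> E")
        case True
        then have "l \<in> {..<d} \<rightarrow>\<^sub>E E" "l ` {..<d} \<subseteq> E" using l by (auto simp: PiE_def)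
        then have "\<not> (inj_on l {..<d} \<and> l ` {..<d} \<in> line_bases)"
          using l by (auto simp: base_tuples_def)
        then show ?thesis using delta_eq[of l] l by (auto simp: PiE_def Pi_def)
      next
        case False
        then obtain i where "i < d" "l i \<notin> E" by blast
        then have "f (l i) = 0" using l by (auto simp: E_def PiE_def Pi_def)
        then show ?thesis using \<open>i < d\<close> by auto
      qed
    next
      fix l assume l: "l \<in> ({..<d} \<rightarrow>\<^sub>E lines0 F d) \<inter> base_tuples"
      then have "delta F d l = 1"
        using delta_eq[of l] by (auto simp: base_tuples_def PiE_def Pi_def)
      then show "delta F d l * (\<Prod>i<d. f (l i)) = (\<Prod>i<d. f (l i))" by simp
    qed (use EL in \<open>auto simp: base_tuples_def PiE_def Pi_def\<close>)
    then show ?thesis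
      using finite_indep_tuples[of d] by (simp add: indep_tuples_eq_base_tuples)
  qed
  show ?thesis
  proof (cases "E = {}")
    case True
    then show ?thesis using infsum_eq[of "\<lambda>_. 1"] by (intro exI[of _ "\<lambda>_. 1"]) simp
  next
    case False
    then have "delta_sum F d f \<noteq> 0" using nondegenerate by (auto simp: E_def)
    then have "base_tuples \<noteq> {}" by (auto simp: delta_sum_eq)
    then obtain B where B: "B \<in> line_bases" "B \<subseteq> E" by (auto simp: base_tuples_def)
    have f_pos: "0 < f l" if "l \<in> E" for l
      using that f_nonneg[of l] by (auto simp: E_def)
    obtain S where S_nonneg: "\<forall>l\<in>E. 0 \<le> S l"
      and S_prod: "\<forall>B\<in>{A\<in>line_bases. A \<subseteq> E}. 1 \<le> prod S B"
      and S_sum: "(\<Sum>l\<in>E. f l * S l) \<le> d * (\<Sum>l\<in>base_tuples. \<Prod>i<d. f (l i)) powr (1 / d)"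
      using weighted_bases[of f, OF f_pos d] by blast
    \<comment> \<open>Each line of the support lies in a base within the support, by exchange with
      \<open>B\<close>, and the product over that base is at least 1. The base \<open>B\<close>
      comes from the nondegeneracy hypothesis.\<close>
    have S_pos: "0 < S l" if l: "l \<in> E" for l
    proof -
      obtain M where M: "insert l (B - {M}) \<in> line_bases"
        using line_in_basis[OF B(1), of l] l EL by blast
      then have "1 \<le> prod S (insert l (B - {M}))" using B l by (intro S_prod[rule_format]) auto
      moreover have "finite (insert l (B - {M}))"
        using B finite_subset[OF B(2) finE] by simp
      ultimately have "S l \<noteq> 0" by (metis insertI1 not_one_le_zero prod_zero)
      then show ?thesis using bspec[OF S_nonneg l] by simp
    qed
    \<comment> \<open>Inserting 1 ensures \<open>m \<le> 1\<close>, so powers of \<open>m\<close>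
      decrease.\<close>
    define m where "m = Min (insert 1 (S ` E))"
    have m: "0 < m" "m \<le> 1" "\<And>l. l \<in> E \<Longrightarrow> m \<le> S l"
      using finE S_pos by (auto simp: m_def)
    \<comment> \<open>In a product of \<open>d\<close> weights with at least one line outside
      \<open>E\<close>, the factor \<open>1 / m ^ d\<close> outweighs the other
      \<open>d - 1\<close>, each of which is at least \<open>m\<close>.\<close>
    define S' where "S' l = (if l \<in> E then S l else 1 / m ^ d)" for l
    have big: "1 \<le> 1 / m ^ d" using m by (simp add: power_le_one)
    have S'_ge: "m \<le> S' l" for l
      using m(3)[of l] order_trans[OF m(2) big] by (simp add: S'_def)
    have "1 \<le> (\<Prod>i<d. S' (l i))" if l: "\<forall>i<d. l i \<in> lines0 F d" "delta F d l = 1" for l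
    proof (cases "\<forall>i<d. l i \<in> E")
      case True
      have inj: "inj_on l {..<d}" and base: "l ` {..<d} \<in> line_bases"
        using l delta_eq[of l] by (auto split: if_splits)
      have "(\<Prod>i<d. S' (l i)) = prod S (l ` {..<d})"
        using True by (simp add: prod.reindex[OF inj] S'_def)
      also have "\<dots> \<ge> 1" using base True by (intro S_prod[rule_format]) auto
      finally show ?thesis .
    next
      case False
      then obtain j where j: "j < d" "l j \<notin> E" by blast
      have "m ^ d \<le> m ^ (d - 1)" using m by (intro power_decreasing) auto
      also have "\<dots> = (\<Prod>i\<in>{..<d} - {j}. m)" using j by simp
      also have "\<dots> \<le> (\<Prod>i\<in>{..<d} - {j}. S' (l i))" using m S'_ge by (intro prod_mono) auto
      finally have "1 / m ^ d * m ^ d \<le> S' (l j) * (\<Prod>i\<in>{..<d} - {j}. S' (l i))"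
        using m j big by (intro mult_mono) (auto simp: S'_def)
      also have "\<dots> = (\<Prod>i<d. S' (l i))" using j by (simp add: prod.remove[of "{..<d}" j])
      finally show ?thesis using m by simp
    qed
    moreover have "\<forall>l. 0 \<le> S' l" using S'_ge m by (meson less_imp_le order_trans)
    moreover have "(\<Sum>\<^sub>\<infinity>l\<in>lines0 F d. S' l * f l) \<le> d * delta_sum F d f powr (1 / d)"
      using S_sum by (simp add: infsum_eq delta_sum_eq S'_def)
    ultimately show ?thesis by blast
  qed
qed

end

theorem theorem5:
  fixes d :: nat
  assumes "d \<ge> 1"
  shows "\<exists>C::real. \<forall>F::'a ring. field F \<longrightarrow>
    (\<forall>f::(nat \<Rightarrow> 'a) set \<Rightarrow> real.
       (\<forall>l\<in>lines0 F d. 0 \<le> f l) \<longrightarrow>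
       finite {l\<in>lines0 F d. f l \<noteq> 0} \<longrightarrow>
       ((\<exists>l\<in>lines0 F d. f l \<noteq> 0) \<longrightarrow> delta_sum F d f \<noteq> 0) \<longrightarrow>
       (\<exists>S::(nat \<Rightarrow> 'a) set \<Rightarrow> real.
          (\<forall>l\<in>lines0 F d. 0 \<le> S l) \<and>
          (\<forall>l. (\<forall>i<d. l i \<in> lines0 F d) \<and> delta F d l = 1 \<longrightarrow> (\<Prod>i<d. S (l i)) \<ge> 1) \<and>
          (\<Sum>\<^sub>\<infinity> l \<in> lines0 F d. S l * f l) \<le> C * delta_sum F d f powr (1 / real d)))"
proof (intro exI[of _ "real d"] allI impI)
  fix F :: "'a ring" and f :: "(nat \<Rightarrow> 'a) set \<Rightarrow> real"
  assume "field F"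
  then interpret field F .
  interpret coordinate_space F d
    by (intro coordinate_space.intro vectorspace.intro func_space_is_module field_axioms)
  assume "\<forall>l\<in>lines0 F d. 0 \<le> f l" and "finite {l\<in>lines0 F d. f l \<noteq> 0}"
    and "(\<exists>l\<in>lines0 F d. f l \<noteq> 0) \<longrightarrow> delta_sum F d f \<noteq> 0"
  then show "\<exists>S::(nat \<Rightarrow> 'a) set \<Rightarrow> real.
      (\<forall>l\<in>lines0 F d. 0 \<le> S l) \<and>
      (\<forall>l. (\<forall>i<d. l i \<in> lines0 F d) \<and> delta F d l = 1 \<longrightarrow> (\<Prod>i<d. S (l i)) \<ge> 1) \<and>
      (\<Sum>\<^sub>\<infinity> l \<in> lines0 F d. S l * f l) \<le> real d * delta_sum F d f powr (1 / real d)"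
    using assms by (intro line_weights) auto
qed

end
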